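(* Let $k\ge1$ and consider the equation of state (virial expansion) $$P=T\sum_{i=1}^k n_i+\sum_{m\in\mathbb Z_+^k,\ |m|\ge2}B_m\,n^m,\qquad n=(n_1,\dots,n_k),\ n^m=n_1^{m_1}\cdots n_k^{m_k},\ |m|=m_1+\dots+m_k,$$ where the virial coefficients $B_m=B_m(T)$ are analytic functions of $T$ near $T=0$ (and the right-hand side is analytic in $(T,n)$ near the origin). Then for each integer $M\ge2$, all the virial coefficients $B_m$ with $|m|\le M$ can be eliminated by a contact transformation; that is, there is a contact transformation near the origin of the space of variables $(\mu_1,\dots,\mu_k,T,n_1,\dots,n_k,s,P)$ that carries the hypersurface given by the equation $P=T\sum_{i=1}^k n_i+\sum_{m\in\mathbb Z_+^k,\ |m|\ge2}B_m(T)\,n^m$ to a hypersurface given, in the new variables, by an equation of the same form $$\widetilde P=\widetilde T\sum_{i=1}^k\widetilde n_i+\sum_{|m|>M}\widetilde B_m(\widetilde T)\,\widetilde n^m .$$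
   Context: The variables $(\mu_1,\dots,\mu_k,T,n_1,\dots,n_k,s,P)\in\mathbb R^{2k+3}$ (chemical potentials, temperature, volume concentrations, entropy density, pressure) carry the contact form $\omega=dP-s\,dT-\sum_{i=1}^k n_i\,d\mu_i$ (Gibbs–Duhem form). A contact transformation is a (local, analytic) diffeomorphism $f$ with $f^*\omega=\Lambda\,\omega$ for some nowhere vanishing function $\Lambda$. All functions are assumed analytic in a neighbourhood of the origin. *)

theory Defs
  imports "HOL-Analysis.Analysis"
begin

section \<open>Real analytic maps\<close>

text \<open>Multi-indices are functions on the whole type that vanish outside the standard basis.
  In finite dimension, convergence in the sense of \<^const>\<open>has_sum\<close> of a power series on a ball
  is the usual absolute convergence.\<close>

definition multi_indices :: "('a::euclidean_space \<Rightarrow> nat) set" where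
  "multi_indices = {m. \<forall>b. b \<notin> Basis \<longrightarrow> m b = 0}"

definition real_analytic_at ::
  "('a::euclidean_space \<Rightarrow> 'b::real_normed_vector) \<Rightarrow> 'a \<Rightarrow> bool" where
  "real_analytic_at f x \<longleftrightarrow>
     (\<exists>(c :: ('a \<Rightarrow> nat) \<Rightarrow> 'b) r. r > 0 \<and>
        (\<forall>y\<in>ball x r.
           ((\<lambda>m. (\<Prod>b\<in>Basis. ((y - x) \<bullet> b) ^ m b) *\<^sub>R c m) has_sum f y) multi_indices))"

definition real_analytic_on ::
  "('a::euclidean_space \<Rightarrow> 'b::real_normed_vector) \<Rightarrow> 'a set \<Rightarrow> bool" where
  "real_analytic_on f S \<longleftrightarrow> (\<forall>x\<in>S. real_analytic_at f x)"

definition real_analytic_near ::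
  "('a::euclidean_space \<Rightarrow> 'b::real_normed_vector) \<Rightarrow> 'a \<Rightarrow> bool" where
  "real_analytic_near f x \<longleftrightarrow> (\<exists>S. open S \<and> x \<in> S \<and> real_analytic_on f S)"

definition analytic_diffeomorphism ::
  "('a::euclidean_space \<Rightarrow> 'b::euclidean_space) \<Rightarrow> 'a set \<Rightarrow> 'b set \<Rightarrow> bool" where
  "analytic_diffeomorphism f U V \<longleftrightarrow>
     open U \<and> open V \<and> bij_betw f U V \<and>
     real_analytic_on f U \<and> real_analytic_on (inv_into U f) V"

section \<open>Contact transformations of the thermodynamic phase space\<close>

text \<open>The coordinates are \<open>(\<mu>, T, n, s, P)\<close>, with \<open>\<mu>\<close> and \<open>n\<close> indexed by the finite type \<open>'k\<close>
  of chemical components, so the dimension is \<open>2 * CARD('k) + 3\<close>.\<close>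

type_synonym 'k phase = "(real, 'k) vec \<times> real \<times> (real, 'k) vec \<times> real \<times> real"

text \<open>A 1-form is represented as a function of a base point and a tangent vector.\<close>

fun gibbs_duhem_form :: "'k::finite phase \<Rightarrow> 'k phase \<Rightarrow> real" where
  "gibbs_duhem_form (\<mu>, T, n, s, P) (d\<mu>, dT, dn, ds, dP) =
     dP - s * dT - (\<Sum>i\<in>UNIV. n $ i * d\<mu> $ i)"

definition pullback ::
  "('a::real_normed_vector \<Rightarrow> 'b::real_normed_vector) \<Rightarrow> ('b \<Rightarrow> 'b \<Rightarrow> real) \<Rightarrow> 'a \<Rightarrow> 'a \<Rightarrow> real" where
  "pullback f \<alpha> x v = \<alpha> (f x) (frechet_derivative f (at x) v)"

definition contact_transformation ::
  "('k::finite phase \<Rightarrow> 'k phase) \<Rightarrow> 'k phase set \<Rightarrow> 'k phase set \<Rightarrow> bool" where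
  "contact_transformation f U V \<longleftrightarrow>
     analytic_diffeomorphism f U V \<and>
     (\<exists>\<Lambda>. real_analytic_on \<Lambda> U \<and>
        (\<forall>x\<in>U. \<Lambda> x \<noteq> 0 \<and>
           (\<forall>v. pullback f gibbs_duhem_form x v = \<Lambda> x * gibbs_duhem_form x v)))"

section \<open>Virial equations of state\<close>

definition mdeg :: "('k::finite \<Rightarrow> nat) \<Rightarrow> nat" where
  "mdeg m = (\<Sum>i\<in>UNIV. m i)"

definition mpow :: "real ^ 'k \<Rightarrow> ('k::finite \<Rightarrow> nat) \<Rightarrow> real" where
  "mpow n m = (\<Prod>i\<in>UNIV. (n $ i) ^ m i)"

definition virial_pressure ::
  "('k::finite \<Rightarrow> nat) set \<Rightarrow> (('k \<Rightarrow> nat) \<Rightarrow> real \<Rightarrow> real) \<Rightarrow> real \<Rightarrow> real ^ 'k \<Rightarrow> real" where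
  "virial_pressure I B T n =
     T * (\<Sum>i\<in>UNIV. n $ i) + (\<Sum>\<^sub>\<infinity>m\<in>I. B m T * mpow n m)"

text \<open>\<open>W\<close> is a neighbourhood of the origin in \<open>(T, n)\<close>-space on which the series converges to an
  analytic function; since \<^const>\<open>infsum\<close> is \<open>0\<close> for divergent families, \<^const>\<open>virial_pressure\<close>
  is meaningful only there.\<close>

definition virial_expansion ::
  "('k::finite \<Rightarrow> nat) set \<Rightarrow> (('k \<Rightarrow> nat) \<Rightarrow> real \<Rightarrow> real) \<Rightarrow> (real \<times> (real ^ 'k)) set \<Rightarrow> bool" where
  "virial_expansion I B W \<longleftrightarrow>
     open W \<and> 0 \<in> W \<and>
     (\<forall>m\<in>I. real_analytic_near (B m) 0) \<and>
     (\<forall>(T, n)\<in>W. (\<lambda>m. B m T * mpow n m) summable_on I) \<and>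
     real_analytic_on (\<lambda>(T, n). virial_pressure I B T n) W"

definition virial_hypersurface ::
  "('k::finite \<Rightarrow> nat) set \<Rightarrow> (('k \<Rightarrow> nat) \<Rightarrow> real \<Rightarrow> real) \<Rightarrow> 'k phase set" where
  "virial_hypersurface I B =
     {(\<mu>, T, n, s, P) | \<mu> T n s P. P = virial_pressure I B T n}"

definition phase_over :: "(real \<times> (real ^ 'k::finite)) set \<Rightarrow> 'k phase set" where
  "phase_over W = {(\<mu>, T, n, s, P) | \<mu> T n s P. (T, n) \<in> W}"

end

theory Submission imports Defs begin

text \<open>The elimination is carried out by one explicit contact transformation. Any smooth function
  \<open>S(T, n)\<close> gives the map
  \<open>(\<mu>, T, n, s, P) \<mapsto> (\<mu> - S\<^sub>n, T, n, s + S\<^sub>T, P + S - n \<bullet> S\<^sub>n)\<close>,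
  where \<open>S\<^sub>T\<close> and \<open>S\<^sub>n\<close> are the partial derivatives of \<open>S\<close>. It preserves
  \<open>dP - s dT - n \<bullet> d\<mu>\<close>: the pressure contributes \<open>dS - d(n \<bullet> S\<^sub>n) = S\<^sub>T dT - n \<bullet> dS\<^sub>n\<close>, and
  these two terms are cancelled by the shifts of \<open>s\<close> and \<open>\<mu>\<close>. It is inverted by replacing \<open>S\<close> with
  \<open>-S\<close>, because \<open>T\<close> and \<open>n\<close> do not move; for the same reason it carries the graph of a pressure
  function \<open>P = F(T, n)\<close> to the graph of \<open>F + S - n \<bullet> S\<^sub>n\<close>.

  The operator \<open>S \<mapsto> S - n \<bullet> S\<^sub>n\<close> multiplies a monomial of degree \<open>|m|\<close> in \<open>n\<close> by \<open>1 - |m|\<close>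
  (Euler's identity), and this factor is nonzero for \<open>|m| \<ge> 2\<close>. Hence
  \<open>S = (\<Sum>2 \<le> |m| \<le> M. B\<^sub>m(T) n\<^sup>m / (|m| - 1))\<close> subtracts exactly the virial terms of degree at
  most \<open>M\<close> and leaves all the other coefficients as they were. Since \<open>S\<close> vanishes to second order
  at \<open>n = 0\<close>, the origin is fixed.

  What remains is regularity: real analytic functions are closed under the operations that build
  \<open>S\<close> and its derivatives. The polynomial dependence on \<open>n\<close> reduces this to sums, products, functions
  of a single coordinate, and the derivative of an analytic function of the one variable \<open>T\<close>.\<close>

section \<open>Calculus of real analytic functions\<close>

abbreviation centred_monomial :: "'a::euclidean_space \<Rightarrow> 'a \<Rightarrow> ('a \<Rightarrow> nat) \<Rightarrow> real" where
  "centred_monomial x y m \<equiv> (\<Prod>b\<in>Basis. ((y - x) \<bullet> b) ^ m b)"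

lemma real_analytic_atI:
  assumes "r > 0"
    and "\<And>y. y \<in> ball x r \<Longrightarrow> ((\<lambda>m. centred_monomial x y m *\<^sub>R c m) has_sum f y) multi_indices"
  shows "real_analytic_at f x"
  unfolding real_analytic_at_def by (intro exI[of _ c] exI[of _ r]) (use assms in simp)

lemma real_analytic_atE:
  assumes "real_analytic_at f x"
  obtains c r where "r > 0"
    and "\<And>y. y \<in> ball x r \<Longrightarrow> ((\<lambda>m. centred_monomial x y m *\<^sub>R c m) has_sum f y) multi_indices"
  using assms unfolding real_analytic_at_def by (elim exE conjE) (rule that, auto)

lemma real_analytic_at_transform:
  assumes "real_analytic_at f x" "open S" "x \<in> S" "\<And>y. y \<in> S \<Longrightarrow> g y = f y"
  shows "real_analytic_at g x"
proof -
  obtain c r where r: "r > 0"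
    and c: "\<And>y. y \<in> ball x r \<Longrightarrow> ((\<lambda>m. centred_monomial x y m *\<^sub>R c m) has_sum f y) multi_indices"
    using assms(1) by (rule real_analytic_atE) (rule that)
  obtain e where e: "e > 0" "ball x e \<subseteq> S"
    using assms(2,3) openE by blast
  show ?thesis
  proof (rule real_analytic_atI)
    show "min r e > 0" using r e by simp
    show "((\<lambda>m. centred_monomial x y m *\<^sub>R c m) has_sum g y) multi_indices"
      if "y \<in> ball x (min r e)" for y
      using that c[of y] assms(4)[of y] e(2) by auto
  qed
qed

lemma real_analytic_at_const [intro]: "real_analytic_at (\<lambda>_. v) x"
proof (rule real_analytic_atI)
  show "(1::real) > 0" by simp
  show "((\<lambda>m. centred_monomial x y m *\<^sub>R (if m = (\<lambda>_. 0) then v else 0)) has_sum v) multi_indices" for y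
    by (rule has_sum_finite_neutralI[where B = "{\<lambda>_. 0}"]) (simp_all add: multi_indices_def)
qed

lemma real_analytic_at_add [intro]:
  assumes "real_analytic_at f x" "real_analytic_at g x"
  shows "real_analytic_at (\<lambda>y. f y + g y) x"
proof -
  obtain c r where r: "r > 0"
    and c: "\<And>y. y \<in> ball x r \<Longrightarrow> ((\<lambda>m. centred_monomial x y m *\<^sub>R c m) has_sum f y) multi_indices"
    using assms(1) by (rule real_analytic_atE) (rule that)
  obtain d q where q: "q > 0"
    and d: "\<And>y. y \<in> ball x q \<Longrightarrow> ((\<lambda>m. centred_monomial x y m *\<^sub>R d m) has_sum g y) multi_indices"
    using assms(2) by (rule real_analytic_atE) (rule that)
  show ?thesis
  proof (rule real_analytic_atI)
    show "min r q > 0" using r q by simp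
    show "((\<lambda>m. centred_monomial x y m *\<^sub>R (c m + d m)) has_sum f y + g y) multi_indices"
      if "y \<in> ball x (min r q)" for y
      unfolding scaleR_add_right using that by (intro has_sum_add c d) auto
  qed
qed

lemma real_analytic_at_bounded_linear:
  assumes "bounded_linear L" "real_analytic_at f x"
  shows "real_analytic_at (\<lambda>y. L (f y)) x"
proof -
  interpret L: bounded_linear L by fact
  obtain c r where r: "r > 0"
    and c: "\<And>y. y \<in> ball x r \<Longrightarrow> ((\<lambda>m. centred_monomial x y m *\<^sub>R c m) has_sum f y) multi_indices"
    using assms(2) by (rule real_analytic_atE) (rule that)
  show ?thesis
  proof (rule real_analytic_atI[OF r])
    show "((\<lambda>m. centred_monomial x y m *\<^sub>R L (c m)) has_sum L (f y)) multi_indices"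
      if "y \<in> ball x r" for y
      using has_sum_bounded_linear[OF assms(1) c[OF that]] by (simp add: L.scaleR)
  qed
qed

lemma real_analytic_at_sum [intro]:
  assumes "\<And>i. i \<in> I \<Longrightarrow> real_analytic_at (f i) x"
  shows "real_analytic_at (\<lambda>y. \<Sum>i\<in>I. f i y) x"
  using assms by (induction I rule: infinite_finite_induct) auto

lemma real_analytic_at_uminus:
  "real_analytic_at f x \<Longrightarrow> real_analytic_at (\<lambda>y. - f y) x"
  using real_analytic_at_bounded_linear[OF bounded_linear_minus[OF bounded_linear_ident]] .

lemma real_analytic_at_diff [intro]:
  "real_analytic_at f x \<Longrightarrow> real_analytic_at g x \<Longrightarrow> real_analytic_at (\<lambda>y. f y - g y) x"
  using real_analytic_at_add[OF _ real_analytic_at_uminus] by fastforce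

lemma real_analytic_at_Pair [intro]:
  assumes "real_analytic_at f x" "real_analytic_at g x"
  shows "real_analytic_at (\<lambda>y. (f y, g y)) x"
proof -
  have "real_analytic_at (\<lambda>y. (f y, 0) + (0, g y)) x"
    by (intro real_analytic_at_add real_analytic_at_bounded_linear[OF _ assms(1)]
        real_analytic_at_bounded_linear[OF _ assms(2)] bounded_linear_Pair
        bounded_linear_ident bounded_linear_zero)
  then show ?thesis by simp
qed

text \<open>A real family that has a sum is absolutely summable, so the product family is dominated by a
  family of nonnegative terms whose iterated sums exist.\<close>

lemma has_sum_times_product:
  fixes a :: "'i \<Rightarrow> real" and b :: "'j \<Rightarrow> real"
  assumes a: "(a has_sum s) A" and b: "(b has_sum t) B"
  shows "((\<lambda>(i, j). a i * b j) has_sum s * t) (A \<times> B)"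
proof (rule has_sum_SigmaI)
  show "((\<lambda>j. case (i, j) of (i, j) \<Rightarrow> a i * b j) has_sum a i * t) B" for i
    using has_sum_cmult_right[OF b] by simp
  show "((\<lambda>i. a i * t) has_sum s * t) A"
    by (rule has_sum_cmult_left[OF a])
  have abs: "(\<lambda>i. \<bar>a i\<bar>) summable_on A" "(\<lambda>j. \<bar>b j\<bar>) summable_on B"
    using iffD1[OF summable_on_iff_abs_summable_on_real has_sum_imp_summable[OF a]]
      iffD1[OF summable_on_iff_abs_summable_on_real has_sum_imp_summable[OF b]]
    by simp_all
  have "(\<lambda>p. \<bar>a (fst p)\<bar> * \<bar>b (snd p)\<bar>) summable_on A \<times> B"
  proof (rule summable_on_SigmaI)
    show "((\<lambda>j. \<bar>a (fst (i, j))\<bar> * \<bar>b (snd (i, j))\<bar>) has_sum \<bar>a i\<bar> * (\<Sum>\<^sub>\<infinity>j\<in>B. \<bar>b j\<bar>)) B" for i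
      using has_sum_cmult_right[OF has_sum_infsum[OF abs(2)]] by simp
    show "(\<lambda>i. \<bar>a i\<bar> * (\<Sum>\<^sub>\<infinity>j\<in>B. \<bar>b j\<bar>)) summable_on A"
      by (rule summable_on_cmult_left[OF abs(1)])
  qed simp
  then have "(\<lambda>p. norm (case p of (i, j) \<Rightarrow> a i * b j)) summable_on A \<times> B"
    by (simp add: case_prod_unfold abs_mult)
  then show "(\<lambda>(i, j). a i * b j) summable_on A \<times> B"
    by (rule iffD2[OF summable_on_iff_abs_summable_on_real])
qed

text \<open>The Cauchy product: the double series is regrouped according to the sum \<open>l\<close> of the two
  exponents. Writing the new coefficient as an infinite sum over the ways to split \<open>l\<close> makes the
  regrouping a plain instance of iterated summation over a dependent sum.\<close>

lemma real_analytic_at_mult [intro]: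
  fixes f g :: "'a::euclidean_space \<Rightarrow> real"
  assumes "real_analytic_at f x" "real_analytic_at g x"
  shows "real_analytic_at (\<lambda>y. f y * g y) x"
proof -
  let ?A = "multi_indices :: ('a \<Rightarrow> nat) set"
  obtain c r where r: "r > 0"
    and c: "\<And>y. y \<in> ball x r \<Longrightarrow> ((\<lambda>m. centred_monomial x y m *\<^sub>R c m) has_sum f y) ?A"
    using assms(1) by (rule real_analytic_atE) (rule that)
  obtain d q where q: "q > 0"
    and d: "\<And>y. y \<in> ball x q \<Longrightarrow> ((\<lambda>m. centred_monomial x y m *\<^sub>R d m) has_sum g y) ?A"
    using assms(2) by (rule real_analytic_atE) (rule that)
  define splittings where
    "splittings l = {p \<in> ?A \<times> ?A. (\<lambda>b. fst p b + snd p b) = l}" for l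
  define e where "e l = (\<Sum>\<^sub>\<infinity>p\<in>splittings l. c (fst p) * d (snd p))" for l
  show ?thesis
  proof (rule real_analytic_atI)
    show "min r q > 0" using r q by simp
    fix y assume y: "y \<in> ball x (min r q)"
    let ?z = "centred_monomial x y"
    define h where "h = (\<lambda>p. ?z (fst p) * c (fst p) * (?z (snd p) * d (snd p)))"
    have h_sum: "(h has_sum f y * g y) (?A \<times> ?A)"
      using has_sum_times_product[OF c d, of y y] y by (simp add: h_def case_prod_unfold)
    have bij: "bij_betw snd (Sigma ?A splittings) (?A \<times> ?A)"
    proof (rule bij_betw_byWitness[where f' = "\<lambda>p. (\<lambda>b. fst p b + snd p b, p)"])
      have "(\<lambda>b. m b + m' b) \<in> ?A" if "m \<in> ?A" "m' \<in> ?A" for m m'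
        using that by (simp add: multi_indices_def)
      then show "(\<lambda>p. (\<lambda>b. fst p b + snd p b, p)) ` (?A \<times> ?A) \<subseteq> Sigma ?A splittings"
        by (auto simp: splittings_def)
    qed (auto simp: splittings_def)
    have sum: "((\<lambda>q. h (snd q)) has_sum f y * g y) (Sigma ?A splittings)"
      using h_sum unfolding has_sum_reindex_bij_betw[OF bij, of h] .
    have h_split: "h p = ?z l * (c (fst p) * d (snd p))" if "p \<in> splittings l" for p l
      using that by (auto simp: h_def splittings_def power_add prod.distrib)
    show "((\<lambda>l. ?z l *\<^sub>R e l) has_sum f y * g y) ?A"
    proof (rule has_sum_SigmaD[OF sum])
      fix l assume l: "l \<in> ?A"
      have "(\<lambda>(l, p). h p) summable_on Sigma ?A splittings"
        using has_sum_imp_summable[OF sum] by (simp add: case_prod_unfold)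
      then have "h summable_on splittings l"
        using l by (rule summable_on_SigmaD1)
      moreover have "infsum h (splittings l) = ?z l *\<^sub>R e l"
        unfolding e_def by (simp add: h_split infsum_cmult_right' cong: infsum_cong)
      ultimately show "((\<lambda>p. h (snd (l, p))) has_sum ?z l *\<^sub>R e l) (splittings l)"
        by (simp add: has_sum_iff)
    qed
  qed
qed

lemma real_analytic_at_power:
  fixes f :: "'a::euclidean_space \<Rightarrow> real"
  assumes "real_analytic_at f x"
  shows "real_analytic_at (\<lambda>y. f y ^ k) x"
  by (induction k) (use assms in auto)

lemma real_analytic_at_prod:
  fixes f :: "'i \<Rightarrow> 'a::euclidean_space \<Rightarrow> real"
  assumes "\<And>i. i \<in> I \<Longrightarrow> real_analytic_at (f i) x"
  shows "real_analytic_at (\<lambda>y. \<Prod>i\<in>I. f i y) x"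
  using assms by (induction I rule: infinite_finite_induct) auto

text \<open>Composition with a map that selects some of the coordinates needs no re-expansion: the
  power series of \<open>f\<close> is already a power series in all the coordinates, with coefficient \<open>0\<close> at
  every exponent that involves a forgotten one. The injection \<open>e\<close> tells which basis vector of the
  larger space carries a given coordinate of the smaller one.\<close>

lemma real_analytic_at_coordinate_projection:
  fixes L :: "'a::euclidean_space \<Rightarrow> 'b::euclidean_space" and e :: "'b \<Rightarrow> 'a"
  assumes f: "real_analytic_at f (L x)"
    and inj: "inj_on e Basis" and e: "e ` Basis \<subseteq> Basis"
    and L: "\<And>y b. b \<in> Basis \<Longrightarrow> L y \<bullet> b = y \<bullet> e b"
  shows "real_analytic_at (\<lambda>y. f (L y)) x"
proof -
  let ?A = "multi_indices :: ('a \<Rightarrow> nat) set" and ?B = "multi_indices :: ('b \<Rightarrow> nat) set"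
  obtain c r where r: "r > 0"
    and c: "\<And>y. y \<in> ball (L x) r \<Longrightarrow> ((\<lambda>m. centred_monomial (L x) y m *\<^sub>R c m) has_sum f y) ?B"
    using f by (rule real_analytic_atE) (rule that)
  have "L = (\<lambda>y. \<Sum>b\<in>Basis. (y \<bullet> e b) *\<^sub>R b)"
  proof
    show "L y = (\<Sum>b\<in>Basis. (y \<bullet> e b) *\<^sub>R b)" for y
      by (subst euclidean_representation[of "L y", symmetric]) (simp add: L)
  qed
  then have "continuous_on UNIV L"
    by (rule ssubst) (intro continuous_intros)
  then have "open (L -` ball (L x) r)"
    by (simp add: open_vimage)
  moreover have "x \<in> L -` ball (L x) r" using r by simp
  ultimately obtain q where q: "q > 0" "ball x q \<subseteq> L -` ball (L x) r"
    using openE by blast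
  \<comment> \<open>\<open>h\<close> extends an exponent by \<open>0\<close> to the forgotten coordinates.\<close>
  define h :: "('b \<Rightarrow> nat) \<Rightarrow> 'a \<Rightarrow> nat" where
    "h m = (\<lambda>a. if a \<in> e ` Basis then m (inv_into Basis e a) else 0)" for m
  have h_e: "h m (e b) = m b" if "b \<in> Basis" for m b
    using that inj by (simp add: h_def)
  have h_multi: "h m \<in> ?A" for m
    using e by (auto simp: h_def multi_indices_def)
  have inj_h: "inj_on h ?B"
  proof (rule inj_onI, rule ext)
    fix m m' b assume "m \<in> ?B" "m' \<in> ?B" "h m = h m'"
    then show "m b = m' b"
      by (cases "b \<in> Basis") (metis h_e, simp add: multi_indices_def)
  qed
  have monomial: "centred_monomial x y (h m) = centred_monomial (L x) (L y) m" for y m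
  proof -
    have "centred_monomial x y (h m) = (\<Prod>a\<in>e ` Basis. ((y - x) \<bullet> a) ^ h m a)"
      using e by (intro prod.mono_neutral_right) (auto simp: h_def)
    also have "\<dots> = (\<Prod>b\<in>Basis. ((y - x) \<bullet> e b) ^ m b)"
      using inj by (simp add: prod.reindex h_e)
    also have "\<dots> = centred_monomial (L x) (L y) m"
      by (simp add: L inner_diff_left)
    finally show ?thesis .
  qed
  define c' where "c' m = (if m \<in> h ` ?B then c (inv_into ?B h m) else 0)" for m
  show ?thesis
  proof (rule real_analytic_atI)
    show "q > 0" by (fact q)
    fix y assume "y \<in> ball x q"
    then have "L y \<in> ball (L x) r" using q by blast
    then have "((\<lambda>m. centred_monomial (L x) (L y) m *\<^sub>R c m) has_sum f (L y)) ?B"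
      by (rule c)
    also have "?this \<longleftrightarrow> ((\<lambda>m. centred_monomial x y (h m) *\<^sub>R c' (h m)) has_sum f (L y)) ?B"
      by (rule has_sum_cong) (simp add: monomial c'_def inj_h)
    also have "\<dots> \<longleftrightarrow> ((\<lambda>m. centred_monomial x y m *\<^sub>R c' m) has_sum f (L y)) (h ` ?B)"
      using has_sum_reindex[OF inj_h, of "\<lambda>m. centred_monomial x y m *\<^sub>R c' m" "f (L y)"]
      by (simp add: o_def)
    also have "\<dots> \<longleftrightarrow> ((\<lambda>m. centred_monomial x y m *\<^sub>R c' m) has_sum f (L y)) ?A"
      by (rule has_sum_cong_neutral) (use h_multi in \<open>auto simp: c'_def\<close>)
    finally show "((\<lambda>m. centred_monomial x y m *\<^sub>R c' m) has_sum f (L y)) ?A" .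
  qed
qed

lemma real_analytic_at_iff_power_series:
  fixes f :: "real \<Rightarrow> 'b::real_normed_vector"
  shows "real_analytic_at f x \<longleftrightarrow>
    (\<exists>c r. r > 0 \<and> (\<forall>y\<in>ball x r. ((\<lambda>j. (y - x) ^ j *\<^sub>R c j) has_sum f y) (UNIV :: nat set)))"
    (is "_ \<longleftrightarrow> ?rhs")
proof -
  define ind :: "nat \<Rightarrow> real \<Rightarrow> nat" where "ind j = (\<lambda>b. if b = 1 then j else 0)" for j
  have bij: "bij_betw ind UNIV multi_indices"
    by (rule bij_betw_byWitness[where f' = "\<lambda>m. m 1"])
      (auto simp: ind_def multi_indices_def)
  have eq: "((\<lambda>m. centred_monomial x y m *\<^sub>R c m) has_sum f y) multi_indices \<longleftrightarrow>
      ((\<lambda>j. (y - x) ^ j *\<^sub>R c (ind j)) has_sum f y) UNIV" for y c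
    using has_sum_reindex_bij_betw[OF bij, of "\<lambda>m. centred_monomial x y m *\<^sub>R c m" "f y"]
    by (simp add: ind_def)
  show ?thesis
  proof
    assume "real_analytic_at f x"
    then show ?rhs unfolding real_analytic_at_def eq by (elim exE) (intro exI)
  next
    assume ?rhs
    then obtain c r where "r > 0"
      and c: "\<forall>y\<in>ball x r. ((\<lambda>j. (y - x) ^ j *\<^sub>R c j) has_sum f y) (UNIV :: nat set)"
      by (elim exE conjE) (rule that)
    moreover have "(\<lambda>j. (y - x) ^ j *\<^sub>R c (ind j 1)) = (\<lambda>j. (y - x) ^ j *\<^sub>R c j)" for y
      by (simp add: ind_def)
    ultimately show "real_analytic_at f x"
      unfolding real_analytic_at_def eq by (intro exI[of _ "\<lambda>m. c (m 1)"] exI[of _ r]) simp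
  qed
qed

lemma real_analytic_at_ident_real: "real_analytic_at (\<lambda>t. t) (x::real)"
  unfolding real_analytic_at_iff_power_series
proof (intro exI conjI ballI)
  show "(1::real) > 0" by simp
  show "((\<lambda>j. (y - x) ^ j *\<^sub>R (if j = 0 then x else if j = 1 then 1 else 0)) has_sum y) UNIV" for y
    by (rule has_sum_finite_neutralI[where B = "{0, 1}"]) auto
qed

lemma real_analytic_at_linear:
  fixes L :: "'a::euclidean_space \<Rightarrow> 'b::real_normed_vector"
  assumes "bounded_linear L"
  shows "real_analytic_at L x"
proof -
  have "real_analytic_at (\<lambda>y. y \<bullet> b) x" if "b \<in> Basis" for b
    by (rule real_analytic_at_coordinate_projection[where e = "\<lambda>_. b"])
      (use that in \<open>auto intro: real_analytic_at_ident_real\<close>)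
  then have "real_analytic_at (\<lambda>y. \<Sum>b\<in>Basis. (y \<bullet> b) *\<^sub>R b) x"
    by (intro real_analytic_at_sum real_analytic_at_bounded_linear[OF bounded_linear_scaleR_left])
  then have "real_analytic_at (\<lambda>y. y) x"
    by (simp add: euclidean_representation)
  from real_analytic_at_bounded_linear[OF assms this] show ?thesis .
qed

text \<open>Termwise differentiation of the power series. Absolute convergence at a point is
  deduced from convergence at a slightly larger radius, which is where \<open>K\<close> comes from.\<close>

lemma real_analytic_at_imp_deriv:
  fixes f :: "real \<Rightarrow> real"
  assumes "real_analytic_at f x"
  shows "f field_differentiable at x" "real_analytic_at (deriv f) x"
proof -
  obtain c r where r: "r > 0"
    and c: "\<And>y. y \<in> ball x r \<Longrightarrow> ((\<lambda>j. (y - x) ^ j *\<^sub>R c j) has_sum f y) UNIV"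
    using iffD1[OF real_analytic_at_iff_power_series assms] by (elim exE conjE) (rule that, auto)
  have sums: "(\<lambda>j. c j * h ^ j) sums f (x + h)" if "norm h < r" for h
    using has_sum_imp_sums[OF c[of "x + h"]] that by (simp add: dist_norm mult.commute)
  have summ: "summable (\<lambda>j. c j * h ^ j)" if "norm h < r" for h
    using sums[OF that] by (rule sums_summable)
  have dsumm: "summable (\<lambda>j. diffs c j * h ^ j)" if "norm h < r" for h
    by (rule termdiff_converges[OF that summ])
  have DERIV: "(f has_field_derivative (\<Sum>j. diffs c j * (y - x) ^ j)) (at y)"
    if y: "y \<in> ball x r" for y
  proof -
    have "((\<lambda>h. \<Sum>j. c j * h ^ j) has_field_derivative (\<Sum>j. diffs c j * (y - x) ^ j)) (at (y - x))"
      by (rule termdiffs_strong'[where K = r]) (use y summ in \<open>auto simp: dist_norm norm_minus_commute\<close>)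
    then have "((\<lambda>z. \<Sum>j. c j * (z - x) ^ j) has_field_derivative
        (\<Sum>j. diffs c j * (y - x) ^ j)) (at y)"
      using DERIV_shift[of "\<lambda>h. \<Sum>j. c j * h ^ j" _ y "- x"] by simp
    then show ?thesis
    proof (rule has_field_derivative_transform_within_open)
      show "open (ball x r)" "y \<in> ball x r" using y by auto
      show "(\<Sum>j. c j * (z - x) ^ j) = f z" if "z \<in> ball x r" for z
        using sums[of "z - x"] that by (auto simp: sums_iff dist_norm norm_minus_commute)
    qed
  qed
  show "f field_differentiable at x"
    using DERIV[of x] r unfolding field_differentiable_def by auto
  show "real_analytic_at (deriv f) x"
    unfolding real_analytic_at_iff_power_series
  proof (intro exI conjI ballI)
    show "r > 0" by (fact r)
    fix y assume y: "y \<in> ball x r"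
    then obtain K where K: "norm (y - x) < K" "K < r"
      using dense[of "norm (y - x)" r] that by (auto simp: dist_real_def abs_minus_commute)
    then have "norm K < r"
      using norm_ge_zero[of "y - x"] by (simp del: norm_ge_zero)
    then have "summable (\<lambda>j. norm (diffs c j * (y - x) ^ j))"
      by (intro powser_insidea[OF dsumm[of K]]) (use K in auto)
    moreover have "(\<lambda>j. diffs c j * (y - x) ^ j) sums deriv f y"
      using DERIV_imp_deriv[OF DERIV[OF y]] dsumm[of "y - x"] y
      by (simp add: sums_iff dist_norm norm_minus_commute)
    ultimately show "((\<lambda>j. (y - x) ^ j *\<^sub>R diffs c j) has_sum deriv f y) UNIV"
      using norm_summable_imp_has_sum[of "\<lambda>j. (y - x) ^ j *\<^sub>R diffs c j"]
      by (simp add: mult.commute)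
  qed
qed

lemma real_analytic_at_inner:
  fixes f g :: "'a::euclidean_space \<Rightarrow> 'b::euclidean_space"
  assumes "real_analytic_at f x" "real_analytic_at g x"
  shows "real_analytic_at (\<lambda>y. f y \<bullet> g y) x"
proof -
  have "real_analytic_at (\<lambda>y. \<Sum>b\<in>Basis. (f y \<bullet> b) * (g y \<bullet> b)) x"
    by (intro real_analytic_at_sum real_analytic_at_mult
        real_analytic_at_bounded_linear[OF bounded_linear_inner_left] assms)
  then show ?thesis
    by (simp add: euclidean_inner[symmetric])
qed

section \<open>Contact transformations generated by a function of temperature and density\<close>

definition temperature_density :: "'k::finite phase \<Rightarrow> real \<times> (real ^ 'k)" where
  "temperature_density x = (fst (snd x), fst (snd (snd x)))"

lemma bounded_linear_temperature_density: "bounded_linear temperature_density"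
  unfolding temperature_density_def
  by (intro bounded_linear_Pair bounded_linear_fst_comp bounded_linear_snd_comp bounded_linear_ident)

lemma phase_over_eq_vimage: "phase_over W = temperature_density -` W"
  by (auto simp: phase_over_def temperature_density_def)

lemma real_analytic_at_temperature_density:
  assumes "real_analytic_at f (temperature_density x)"
  shows "real_analytic_at (\<lambda>y. f (temperature_density y)) x"
proof (rule real_analytic_at_coordinate_projection[where L = temperature_density and
      e = "\<lambda>b. (0, fst b, snd b, 0, 0)"])
  show "inj_on (\<lambda>b. (0, fst b, snd b, 0, 0)) Basis"
    by (auto simp: inj_on_def)
  show "(\<lambda>b. (0, fst b, snd b, 0, 0)) ` Basis \<subseteq> Basis"
    by (auto simp: Basis_prod_def zero_prod_def)
qed (use assms in \<open>auto simp: temperature_density_def inner_prod_def\<close>)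

text \<open>The arguments \<open>S\<^sub>T\<close> and \<open>S\<^sub>n\<close> are meant to be the partial derivatives of \<open>S\<close>. As
  arguments of their own they make the inversion of the map pure algebra: negate all three.\<close>

definition gauge_shift ::
  "(real \<times> (real ^ 'k) \<Rightarrow> real) \<Rightarrow> (real \<times> (real ^ 'k) \<Rightarrow> real) \<Rightarrow> (real \<times> (real ^ 'k) \<Rightarrow> real ^ 'k) \<Rightarrow>
    'k::finite phase \<Rightarrow> 'k phase" where
  "gauge_shift S S\<^sub>T S\<^sub>n = (\<lambda>(\<mu>, T, n, s, P).
     (\<mu> - S\<^sub>n (T, n), T, n, s + S\<^sub>T (T, n), P + S (T, n) - n \<bullet> S\<^sub>n (T, n)))"

lemma temperature_density_gauge_shift [simp]:
  "temperature_density (gauge_shift S S\<^sub>T S\<^sub>n x) = temperature_density x"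
  by (cases x) (simp add: gauge_shift_def temperature_density_def)

lemma gauge_shift_inverse:
  "gauge_shift (\<lambda>z. - S z) (\<lambda>z. - S\<^sub>T z) (\<lambda>z. - S\<^sub>n z) (gauge_shift S S\<^sub>T S\<^sub>n x) = x"
  by (cases x) (simp add: gauge_shift_def)

lemma gauge_shift_selectors:
  "gauge_shift S S\<^sub>T S\<^sub>n = (\<lambda>x. let z = temperature_density x in
    (fst x - S\<^sub>n z, fst (snd x), fst (snd (snd x)), fst (snd (snd (snd x))) + S\<^sub>T z,
     snd (snd (snd (snd x))) + S z - fst (snd (snd x)) \<bullet> S\<^sub>n z))"
  by (auto simp: gauge_shift_def temperature_density_def Let_def)

lemma real_analytic_on_gauge_shift:
  assumes "real_analytic_on S W" "real_analytic_on S\<^sub>T W" "real_analytic_on S\<^sub>n W"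
  shows "real_analytic_on (gauge_shift S S\<^sub>T S\<^sub>n) (phase_over W)"
  unfolding real_analytic_on_def gauge_shift_selectors Let_def
proof
  fix x assume "x \<in> phase_over W"
  then have "temperature_density x \<in> W" by (simp add: phase_over_eq_vimage)
  then have "real_analytic_at S (temperature_density x)" "real_analytic_at S\<^sub>T (temperature_density x)"
    "real_analytic_at S\<^sub>n (temperature_density x)"
    using assms by (auto simp: real_analytic_on_def)
  note analytic = this[THEN real_analytic_at_temperature_density]
  show "real_analytic_at (\<lambda>x. (fst x - S\<^sub>n (temperature_density x), fst (snd x), fst (snd (snd x)),
      fst (snd (snd (snd x))) + S\<^sub>T (temperature_density x),
      snd (snd (snd (snd x))) + S (temperature_density x)
        - fst (snd (snd x)) \<bullet> S\<^sub>n (temperature_density x))) x"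
    by (intro real_analytic_at_Pair real_analytic_at_diff real_analytic_at_add real_analytic_at_inner;
        (fact analytic | intro real_analytic_at_linear bounded_linear_fst_comp bounded_linear_snd_comp
          bounded_linear_ident))
qed

text \<open>Second derivatives of \<open>S\<close> enter the derivative of the map, but cancel from the pulled-back form:
  \<open>dS\<^sub>n\<close> occurs as \<open>-n \<bullet> dS\<^sub>n\<close> in the pressure and again, with the other sign, in \<open>-n \<bullet> d\<mu>\<close>, and
  \<open>dS\<^sub>T\<close> does not occur because the form has no \<open>ds\<close>.\<close>

lemma pullback_gauge_shift:
  assumes S: "(S has_derivative (\<lambda>v. S\<^sub>T z * fst v + S\<^sub>n z \<bullet> snd v)) (at z)"
    and diff: "S\<^sub>T differentiable at z" "S\<^sub>n differentiable at z"
    and z: "z = temperature_density x"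
  shows "pullback (gauge_shift S S\<^sub>T S\<^sub>n) gibbs_duhem_form x v = gibbs_duhem_form x v"
proof -
  let ?z = "temperature_density :: 'a phase \<Rightarrow> _"
  obtain D\<^sub>T D\<^sub>n where D: "(S\<^sub>T has_derivative D\<^sub>T) (at z)" "(S\<^sub>n has_derivative D\<^sub>n) (at z)"
    using diff unfolding differentiable_def by blast
  have z': "(?z has_derivative ?z) (at x)"
    by (rule bounded_linear_imp_has_derivative[OF bounded_linear_temperature_density])
  have [derivative_intros]:
    "((\<lambda>x. S (?z x)) has_derivative (\<lambda>v. S\<^sub>T (?z x) * fst (?z v) + S\<^sub>n (?z x) \<bullet> snd (?z v))) (at x)"
    "((\<lambda>x. S\<^sub>T (?z x)) has_derivative (\<lambda>v. D\<^sub>T (?z v))) (at x)"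
    "((\<lambda>x. S\<^sub>n (?z x)) has_derivative (\<lambda>v. D\<^sub>n (?z v))) (at x)"
    by (rule has_derivative_compose[OF z' S[unfolded z]]
        has_derivative_compose[OF z' D(1)[unfolded z]]
        has_derivative_compose[OF z' D(2)[unfolded z]])+
  have "(gauge_shift S S\<^sub>T S\<^sub>n has_derivative
      (\<lambda>v. (fst v - D\<^sub>n (?z v), fst (snd v), fst (snd (snd v)), fst (snd (snd (snd v))) + D\<^sub>T (?z v),
        snd (snd (snd (snd v))) + (S\<^sub>T z * fst (?z v) + S\<^sub>n z \<bullet> snd (?z v))
          - (fst (snd (snd x)) \<bullet> D\<^sub>n (?z v) + fst (snd (snd v)) \<bullet> S\<^sub>n z)))) (at x)"
    unfolding gauge_shift_selectors Let_def z by (intro derivative_intros)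
  from frechet_derivative_at[OF this, symmetric] show ?thesis
    by (cases x; cases v)
      (simp add: pullback_def gauge_shift_def temperature_density_def z inner_vec_def
        algebra_simps sum_subtractf sum.distrib)
qed

lemma contact_transformation_gauge_shift:
  assumes W: "open W"
    and S: "\<And>z. z \<in> W \<Longrightarrow> (S has_derivative (\<lambda>v. S\<^sub>T z * fst v + S\<^sub>n z \<bullet> snd v)) (at z)"
    and diff: "\<And>z. z \<in> W \<Longrightarrow> S\<^sub>T differentiable at z" "\<And>z. z \<in> W \<Longrightarrow> S\<^sub>n differentiable at z"
    and analytic: "real_analytic_on S W" "real_analytic_on S\<^sub>T W" "real_analytic_on S\<^sub>n W"
  shows "contact_transformation (gauge_shift S S\<^sub>T S\<^sub>n) (phase_over W) (phase_over W)"
proof -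
  let ?f = "gauge_shift S S\<^sub>T S\<^sub>n" and ?U = "phase_over W"
  let ?g = "gauge_shift (\<lambda>z. - S z) (\<lambda>z. - S\<^sub>T z) (\<lambda>z. - S\<^sub>n z)"
  have gf: "?g (?f x) = x" for x by (rule gauge_shift_inverse)
  have fg: "?f (?g x) = x" for x
    using gauge_shift_inverse[of "\<lambda>z. - S z" "\<lambda>z. - S\<^sub>T z" "\<lambda>z. - S\<^sub>n z" x] by simp
  have opn: "open ?U"
    unfolding phase_over_eq_vimage
    by (rule open_vimage[OF W linear_continuous_on[OF bounded_linear_temperature_density]])
  have bij: "bij_betw ?f ?U ?U"
    by (rule bij_betw_byWitness[where f' = ?g]) (auto simp: gf fg phase_over_eq_vimage)
  have "real_analytic_on ?g ?U"
    by (rule real_analytic_on_gauge_shift)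
      (use analytic in \<open>auto simp: real_analytic_on_def intro: real_analytic_at_uminus\<close>)
  moreover have "inv_into ?U ?f y = ?g y" if "y \<in> ?U" for y
    by (rule inv_into_f_eq[OF bij_betw_imp_inj_on[OF bij]])
      (use that in \<open>simp_all add: fg phase_over_eq_vimage\<close>)
  ultimately have "real_analytic_on (inv_into ?U ?f) ?U"
    unfolding real_analytic_on_def using real_analytic_at_transform[OF _ opn] by blast
  then have "analytic_diffeomorphism ?f ?U ?U"
    unfolding analytic_diffeomorphism_def
    using opn bij real_analytic_on_gauge_shift[OF analytic] by blast
  moreover have "pullback ?f gibbs_duhem_form x v = 1 * gibbs_duhem_form x v" if "x \<in> ?U" for x v
    using pullback_gauge_shift[OF S diff refl] that by (simp add: phase_over_eq_vimage)
  moreover have "real_analytic_on (\<lambda>_. 1 :: real) ?U"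
    by (auto simp: real_analytic_on_def)
  ultimately show ?thesis
    unfolding contact_transformation_def by (intro conjI exI[of _ "\<lambda>_. 1"]) auto
qed

section \<open>Finite virial sums and their derivatives\<close>

definition virial_sum ::
  "('k::finite \<Rightarrow> nat) set \<Rightarrow> (('k \<Rightarrow> nat) \<Rightarrow> real \<Rightarrow> real) \<Rightarrow> real \<times> (real ^ 'k) \<Rightarrow> real" where
  "virial_sum I b z = (\<Sum>m\<in>I. b m (fst z) * mpow (snd z) m)"

text \<open>The gradient of \<^const>\<open>virial_sum\<close> in the densities. Where \<open>m i = 0\<close>, truncated subtraction makes
  the decreased exponent meaningless, but the factor \<open>m i\<close> removes the term.\<close>

definition virial_gradient ::
  "('k::finite \<Rightarrow> nat) set \<Rightarrow> (('k \<Rightarrow> nat) \<Rightarrow> real \<Rightarrow> real) \<Rightarrow> real \<times> (real ^ 'k) \<Rightarrow> real ^ 'k" where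
  "virial_gradient I b z = (\<Sum>m\<in>I. \<Sum>i\<in>UNIV.
     (real (m i) * (b m (fst z) * mpow (snd z) (m(i := m i - 1)))) *\<^sub>R axis i 1)"

lemma mpow_decrement:
  "mpow n (m(i := m i - 1)) = n $ i ^ (m i - 1) * (\<Prod>j\<in>UNIV - {i}. n $ j ^ m j)"
  unfolding mpow_def by (subst prod.remove[of UNIV i]) auto

lemma mpow_has_derivative:
  "((\<lambda>n. mpow n m) has_derivative
     (\<lambda>v. \<Sum>i\<in>UNIV. real (m i) * mpow n (m(i := m i - 1)) * v $ i)) (at n)"
proof -
  have "((\<lambda>n. n $ i ^ m i) has_derivative (\<lambda>v. real (m i) * v $ i * n $ i ^ (m i - 1))) (at n)" for i
    by (intro has_derivative_power bounded_linear_imp_has_derivative bounded_linear_vec_nth)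
  from has_derivative_prod[where I = UNIV, OF this] show ?thesis
    unfolding mpow_decrement by (simp add: mpow_def mult_ac)
qed

lemma mpow_zero_eq_0:
  assumes "0 < mdeg m"
  shows "mpow 0 m = 0"
proof -
  have "mdeg m \<noteq> 0" using assms by simp
  then obtain i where "0 < m i"
    unfolding mdeg_def by (rule sum.not_neutral_contains_not_neutral) simp
  then show ?thesis
    unfolding mpow_def by (intro prod_zero) auto
qed

lemma mult_mpow_decrement: "real (m i) * mpow n (m(i := m i - 1)) * n $ i = real (m i) * mpow n m"
proof (cases "m i")
  case (Suc k)
  have "mpow n m = n $ i ^ m i * (\<Prod>j\<in>UNIV - {i}. n $ j ^ m j)"
    unfolding mpow_def by (subst prod.remove[of UNIV i]) auto
  then show ?thesis
    unfolding mpow_decrement by (simp add: Suc)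
qed simp

lemma virial_term_has_derivative:
  assumes "(b has_real_derivative b') (at (fst z))"
  shows "((\<lambda>z. b (fst z) * mpow (snd z) m) has_derivative
    (\<lambda>v. b' * mpow (snd z) m * fst v +
       (\<Sum>i\<in>UNIV. real (m i) * (b (fst z) * mpow (snd z) (m(i := m i - 1))) * snd v $ i))) (at z)"
proof -
  have "((\<lambda>z. b (fst z)) has_derivative (\<lambda>v. b' * fst v)) (at z)"
    using has_derivative_compose[OF bounded_linear_imp_has_derivative[OF bounded_linear_fst]
        assms[unfolded has_field_derivative_def]] by simp
  moreover have "((\<lambda>z. mpow (snd z) m) has_derivative
      (\<lambda>v. \<Sum>i\<in>UNIV. real (m i) * mpow (snd z) (m(i := m i - 1)) * snd v $ i)) (at z)"
    by (rule has_derivative_compose[OF bounded_linear_imp_has_derivative[OF bounded_linear_snd]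
          mpow_has_derivative])
  ultimately have "((\<lambda>z. b (fst z) * mpow (snd z) m) has_derivative
      (\<lambda>v. b (fst z) * (\<Sum>i\<in>UNIV. real (m i) * mpow (snd z) (m(i := m i - 1)) * snd v $ i) +
         b' * fst v * mpow (snd z) m)) (at z)"
    by (rule has_derivative_mult)
  then show ?thesis
    by (simp add: sum_distrib_left mult_ac add.commute)
qed

lemma real_analytic_at_virial_term:
  assumes "real_analytic_at b (fst z)"
  shows "real_analytic_at (\<lambda>z. b (fst z) * mpow (snd z) m) z"
proof (rule real_analytic_at_mult)
  show "real_analytic_at (\<lambda>z. b (fst z)) z"
  proof (rule real_analytic_at_coordinate_projection[where L = fst and e = "\<lambda>b. (b, 0)"])
    show "real_analytic_at b (fst z)" by fact
    show "inj_on (\<lambda>b. (b, 0)) Basis" by (rule inj_onI) simp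
  qed (auto simp: Basis_prod_def inner_prod_def)
  show "real_analytic_at (\<lambda>z. mpow (snd z) m) z"
    unfolding mpow_def
    by (intro real_analytic_at_prod real_analytic_at_power real_analytic_at_linear
        bounded_linear_compose[OF bounded_linear_vec_nth bounded_linear_snd])
qed

lemma real_analytic_at_virial_sum:
  assumes "\<And>m. m \<in> I \<Longrightarrow> real_analytic_at (b m) (fst z)"
  shows "real_analytic_at (virial_sum I b) z"
  unfolding virial_sum_def using assms
  by (intro real_analytic_at_sum real_analytic_at_virial_term)

lemma real_analytic_at_virial_gradient:
  assumes "\<And>m. m \<in> I \<Longrightarrow> real_analytic_at (b m) (fst z)"
  shows "real_analytic_at (virial_gradient I b) z"
  unfolding virial_gradient_def using assms
  by (intro real_analytic_at_sum real_analytic_at_bounded_linear[OF bounded_linear_scaleR_left]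
      real_analytic_at_mult real_analytic_at_const real_analytic_at_virial_term)

lemma inner_virial_gradient:
  "virial_gradient I b z \<bullet> v =
    (\<Sum>m\<in>I. \<Sum>i\<in>UNIV. real (m i) * (b m (fst z) * mpow (snd z) (m(i := m i - 1))) * v $ i)"
  by (simp add: virial_gradient_def inner_sum_left inner_axis')

lemma virial_sum_has_derivative:
  assumes "\<And>m. m \<in> I \<Longrightarrow> b m field_differentiable at (fst z)"
  shows "(virial_sum I b has_derivative
    (\<lambda>v. virial_sum I (\<lambda>m. deriv (b m)) z * fst v + virial_gradient I b z \<bullet> snd v)) (at z)"
proof -
  have "(virial_sum I b has_derivative (\<lambda>v. \<Sum>m\<in>I. deriv (b m) (fst z) * mpow (snd z) m * fst v +
      (\<Sum>i\<in>UNIV. real (m i) * (b m (fst z) * mpow (snd z) (m(i := m i - 1))) * snd v $ i))) (at z)"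
    unfolding virial_sum_def
    by (intro has_derivative_sum virial_term_has_derivative)
      (simp add: assms field_differentiable_derivI)
  then show ?thesis
    by (simp add: inner_virial_gradient virial_sum_def sum.distrib sum_distrib_right)
qed

lemma virial_gradient_differentiable:
  assumes "finite I" and "\<And>m. m \<in> I \<Longrightarrow> b m field_differentiable at (fst z)"
  shows "virial_gradient I b differentiable at z"
proof -
  have "(\<lambda>z. b m (fst z) * mpow (snd z) m') differentiable at z" if "m \<in> I" for m m'
    using virial_term_has_derivative[OF field_differentiable_derivI[OF assms(2)[OF that]]]
    by (rule differentiableI)
  note summand = differentiable_scaleR[OF differentiable_mult[OF differentiable_const this]
      differentiable_const]
  show ?thesis
    unfolding virial_gradient_def
    by (intro differentiable_sum ballI assms(1) summand) simp_all
qed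

text \<open>Euler's identity for homogeneous polynomials, applied to each monomial in the densities.\<close>

lemma virial_sum_euler:
  "snd z \<bullet> virial_gradient I b z = virial_sum I (\<lambda>m T. real (mdeg m) * b m T) z"
proof -
  have "(\<Sum>i\<in>UNIV. real (m i) * (b m (fst z) * mpow (snd z) (m(i := m i - 1))) * snd z $ i) =
      real (mdeg m) * b m (fst z) * mpow (snd z) m" for m
  proof -
    have "(\<Sum>i\<in>UNIV. real (m i) * (b m (fst z) * mpow (snd z) (m(i := m i - 1))) * snd z $ i) =
        (\<Sum>i\<in>UNIV. b m (fst z) * (real (m i) * mpow (snd z) (m(i := m i - 1)) * snd z $ i))"
      by (simp add: mult_ac)
    then show ?thesis
      unfolding mult_mpow_decrement mdeg_def
      by (simp add: sum_distrib_left sum_distrib_right mult_ac)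
  qed
  then show ?thesis
    by (simp add: inner_commute[of "snd z"] inner_virial_gradient virial_sum_def)
qed

lemma virial_sum_zero:
  assumes "\<And>m. m \<in> I \<Longrightarrow> 2 \<le> mdeg m"
  shows "virial_sum I b (T, 0) = 0"
  unfolding virial_sum_def
proof (rule sum.neutral, rule ballI)
  show "b m (fst (T, 0)) * mpow (snd (T, 0)) m = 0" if "m \<in> I" for m
    using assms[OF that] by (simp add: mpow_zero_eq_0)
qed

text \<open>Terms of degree at least two have a gradient without constant term. This is what keeps the origin
  fixed: its chemical potentials are shifted by the value of the gradient there.\<close>

lemma virial_gradient_zero:
  assumes "\<And>m. m \<in> I \<Longrightarrow> 2 \<le> mdeg m"
  shows "virial_gradient I b (T, 0) = 0"
proof -
  have "real (m i) * (c * mpow 0 (m(i := m i - 1))) = 0" if "m \<in> I" for m i c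
  proof -
    have "mdeg m = m i + (\<Sum>j\<in>UNIV - {i}. m j)"
      unfolding mdeg_def by (rule sum.remove) auto
    moreover have "mdeg (m(i := m i - 1)) = (m i - 1) + (\<Sum>j\<in>UNIV - {i}. m j)"
      unfolding mdeg_def by (subst sum.remove[of UNIV i]) auto
    ultimately have "m i = 0 \<or> 0 < mdeg (m(i := m i - 1))"
      using assms[OF that] by linarith
    then show ?thesis by (auto simp: mpow_zero_eq_0)
  qed
  then show ?thesis
    unfolding virial_gradient_def
    by (intro sum.neutral ballI) (simp only: fst_conv snd_conv scaleR_zero_left)
qed

lemma finite_mdeg_le: "finite {m :: 'k::finite \<Rightarrow> nat. mdeg m \<le> M}"
proof (rule finite_subset)
  show "{m :: 'k \<Rightarrow> nat. mdeg m \<le> M} \<subseteq> (UNIV :: 'k set) \<rightarrow>\<^sub>E {..M}"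
  proof
    fix m :: "'k \<Rightarrow> nat" assume "m \<in> {m. mdeg m \<le> M}"
    moreover have "m i \<le> mdeg m" for i
      unfolding mdeg_def by (rule member_le_sum) simp_all
    ultimately have "m i \<le> M" for i
      using order_trans by blast
    then show "m \<in> UNIV \<rightarrow>\<^sub>E {..M}" by (auto simp: PiE_UNIV_domain)
  qed
  show "finite ((UNIV :: 'k set) \<rightarrow>\<^sub>E {..M})"
    by (rule finite_PiE) simp_all
qed

lemma virial_pressure_split:
  assumes "(\<lambda>m. B m T * mpow n m) summable_on {m. 2 \<le> mdeg m}" "2 \<le> M"
  shows "virial_pressure {m. 2 \<le> mdeg m} B T n =
    virial_pressure {m. M < mdeg m} B T n + virial_sum {m. 2 \<le> mdeg m \<and> mdeg m \<le> M} B (T, n)"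
proof -
  let ?F = "{m. 2 \<le> mdeg m \<and> mdeg m \<le> M}"
  have fin: "finite ?F" by (rule finite_subset[OF _ finite_mdeg_le[of M]]) auto
  have split: "{m. 2 \<le> mdeg m} = {m. M < mdeg m} \<union> ?F" using assms(2) by auto
  have "(\<Sum>\<^sub>\<infinity>m\<in>{m. 2 \<le> mdeg m}. B m T * mpow n m) =
      (\<Sum>\<^sub>\<infinity>m\<in>{m. M < mdeg m}. B m T * mpow n m) + (\<Sum>\<^sub>\<infinity>m\<in>?F. B m T * mpow n m)"
    unfolding split
  proof (rule infsum_Un_disjoint)
    show "(\<lambda>m. B m T * mpow n m) summable_on {m. M < mdeg m}"
      by (rule summable_on_subset[OF assms(1)]) (use assms(2) in auto)
    show "(\<lambda>m. B m T * mpow n m) summable_on ?F"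
      by (rule summable_on_finite[OF fin])
  qed auto
  then show ?thesis
    unfolding infsum_finite[OF fin] by (simp add: virial_pressure_def virial_sum_def)
qed

section \<open>Elimination of the virial coefficients\<close>

theorem theorem3:
  fixes B :: "('k::finite \<Rightarrow> nat) \<Rightarrow> real \<Rightarrow> real"
    and W :: "(real \<times> (real ^ 'k)) set"
    and M :: nat
  assumes "virial_expansion {m. 2 \<le> mdeg m} B W"
    and "2 \<le> M"
  shows "\<exists>(f :: 'k phase \<Rightarrow> 'k phase) U V B' W'.
           contact_transformation f U V \<and> 0 \<in> U \<and> f 0 = 0 \<and>
           virial_expansion {m. M < mdeg m} B' W' \<and>
           U \<subseteq> phase_over W \<and> V \<subseteq> phase_over W' \<and>
           f ` (U \<inter> virial_hypersurface {m. 2 \<le> mdeg m} B) =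
             V \<inter> virial_hypersurface {m. M < mdeg m} B'"
proof -
  define F :: "('k \<Rightarrow> nat) set" where "F = {m. 2 \<le> mdeg m \<and> mdeg m \<le> M}"
  have fin: "finite F"
    unfolding F_def by (rule finite_subset[OF _ finite_mdeg_le[of M]]) auto
  note expansion_B = assms(1)[unfolded virial_expansion_def case_prod_unfold]
  have W: "open W" "0 \<in> W"
    using expansion_B by simp_all
  have B: "real_analytic_near (B m) 0" if "2 \<le> mdeg m" for m
    using expansion_B that by simp
  have summable: "(\<lambda>m. B m (fst z) * mpow (snd z) m) summable_on {m. 2 \<le> mdeg m}" if "z \<in> W" for z
    using expansion_B that by simp
  have pressure: "real_analytic_on (\<lambda>z. virial_pressure {m. 2 \<le> mdeg m} B (fst z) (snd z)) W"
    using expansion_B by simp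
  have "\<forall>m\<in>F. \<exists>D. open D \<and> 0 \<in> D \<and> real_analytic_on (B m) D"
    using B by (simp add: F_def real_analytic_near_def)
  then have "\<exists>D. \<forall>m\<in>F. open (D m) \<and> 0 \<in> D m \<and> real_analytic_on (B m) (D m)"
    by (rule bchoice)
  then obtain D where D: "\<forall>m\<in>F. open (D m) \<and> 0 \<in> D m \<and> real_analytic_on (B m) (D m)"
    by (rule exE)
  \<comment> \<open>Finitely many coefficients are eliminated, so they have a common open domain of analyticity.\<close>
  define W' where "W' = W \<inter> fst -` (\<Inter>m\<in>F. D m)"
  have W': "open W'" "0 \<in> W'" "W' \<subseteq> W"
  proof -
    have "open (\<Inter>m\<in>F. D m)"
      using fin D by (intro open_INT ballI) simp_all
    then show "open W'"
      unfolding W'_def by (intro open_Int W(1) open_vimage_fst)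
    show "0 \<in> W'" "W' \<subseteq> W"
      using W(2) D by (simp_all add: W'_def)
  qed
  have B_analytic: "real_analytic_at (B m) (fst z)" if "m \<in> F" "z \<in> W'" for m z
    using that D by (simp add: W'_def real_analytic_on_def)

  \<comment> \<open>The divisor compensates the factor \<open>1 - |m|\<close> by which \<open>S \<mapsto> S - n \<bullet> S\<^sub>n\<close> acts in degree \<open>|m|\<close>.\<close>
  define b where "b m = (\<lambda>T. B m T * (1 / real (mdeg m - 1)))" for m
  have b: "real_analytic_at (b m) (fst z)" if "m \<in> F" "z \<in> W'" for m z
    unfolding b_def by (intro real_analytic_at_mult B_analytic[OF that] real_analytic_at_const)
  define S where "S = virial_sum F b"
  define S\<^sub>T where "S\<^sub>T = virial_sum F (\<lambda>m. deriv (b m))"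
  define S\<^sub>n where "S\<^sub>n = virial_gradient F b"
  define f where "f = gauge_shift S S\<^sub>T S\<^sub>n"
  have contact: "contact_transformation f (phase_over W') (phase_over W')"
    unfolding f_def
  proof (rule contact_transformation_gauge_shift)
    show "open W'" by (rule W')
    fix z assume z: "z \<in> W'"
    note diff = real_analytic_at_imp_deriv(1)
    show "(S has_derivative (\<lambda>v. S\<^sub>T z * fst v + S\<^sub>n z \<bullet> snd v)) (at z)"
      unfolding S_def S\<^sub>T_def S\<^sub>n_def by (intro virial_sum_has_derivative diff b z)
    show "S\<^sub>n differentiable at z"
      unfolding S\<^sub>n_def by (intro virial_gradient_differentiable fin diff b z)
    have "(S\<^sub>T has_derivative
        (\<lambda>v. virial_sum F (\<lambda>m. deriv (deriv (b m))) z * fst v +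
           virial_gradient F (\<lambda>m. deriv (b m)) z \<bullet> snd v)) (at z)"
      unfolding S\<^sub>T_def by (intro virial_sum_has_derivative diff real_analytic_at_imp_deriv(2) b z)
    then show "S\<^sub>T differentiable at z"
      by (rule differentiableI)
  next
    show "real_analytic_on S W'"
      unfolding S_def real_analytic_on_def by (intro ballI real_analytic_at_virial_sum b)
    show "real_analytic_on S\<^sub>T W'"
      unfolding S\<^sub>T_def real_analytic_on_def
      by (intro ballI real_analytic_at_virial_sum real_analytic_at_imp_deriv(2) b)
    show "real_analytic_on S\<^sub>n W'"
      unfolding S\<^sub>n_def real_analytic_on_def by (intro ballI real_analytic_at_virial_gradient b)
  qed

  have S_legendre: "S z - snd z \<bullet> S\<^sub>n z = - virial_sum F B z" for z
  proof -
    have "b m T - real (mdeg m) * b m T = - B m T" if "m \<in> F" for m T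
    proof -
      define d where "d = real (mdeg m - 1)"
      have "d \<noteq> 0" "real (mdeg m) = d + 1"
        using that by (auto simp: d_def F_def)
      then show ?thesis
        unfolding b_def d_def[symmetric] by (simp add: field_simps)
    qed
    then have "(\<Sum>m\<in>F. (b m (fst z) - real (mdeg m) * b m (fst z)) * mpow (snd z) m) =
        (\<Sum>m\<in>F. - B m (fst z) * mpow (snd z) m)"
      by (intro sum.cong) simp_all
    then show ?thesis
      unfolding S_def S\<^sub>n_def virial_sum_euler virial_sum_def
      by (simp add: left_diff_distrib sum_subtractf sum_negf)
  qed
  have split: "virial_pressure {m. 2 \<le> mdeg m} B T n =
      virial_pressure {m. M < mdeg m} B T n + virial_sum F B (T, n)" if "(T, n) \<in> W'" for T n
  proof -
    have "(\<lambda>m. B m T * mpow n m) summable_on {m. 2 \<le> mdeg m}"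
      using summable[of "(T, n)"] that W'(3) by auto
    then show ?thesis
      unfolding F_def using assms(2) by (rule virial_pressure_split)
  qed

  have expansion: "virial_expansion {m. M < mdeg m} B W'"
    unfolding virial_expansion_def
  proof (intro conjI)
    show "\<forall>m\<in>{m. M < mdeg m}. real_analytic_near (B m) 0"
      using B assms(2) by simp
    show "\<forall>(T, n)\<in>W'. (\<lambda>m. B m T * mpow n m) summable_on {m. M < mdeg m}"
    proof clarify
      fix T n assume "(T, n) \<in> W'"
      then have "(\<lambda>m. B m T * mpow n m) summable_on {m. 2 \<le> mdeg m}"
        using summable[of "(T, n)"] W'(3) by auto
      then show "(\<lambda>m. B m T * mpow n m) summable_on {m. M < mdeg m}"
        by (rule summable_on_subset) (use assms(2) in auto)
    qed
    show "real_analytic_on (\<lambda>(T, n). virial_pressure {m. M < mdeg m} B T n) W'"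
      unfolding real_analytic_on_def
    proof
      fix z assume z: "z \<in> W'"
      have "real_analytic_at (\<lambda>z. virial_pressure {m. 2 \<le> mdeg m} B (fst z) (snd z) - virial_sum F B z) z"
        using pressure z W'(3)
        by (intro real_analytic_at_diff real_analytic_at_virial_sum B_analytic)
          (auto simp: real_analytic_on_def)
      then show "real_analytic_at (\<lambda>(T, n). virial_pressure {m. M < mdeg m} B T n) z"
        by (rule real_analytic_at_transform[OF _ W'(1) z]) (auto simp: split)
    qed
  qed (use W' in auto)

  have bij: "bij_betw f (phase_over W') (phase_over W')"
    using contact by (simp add: contact_transformation_def analytic_diffeomorphism_def)
  have hypersurface: "f x \<in> virial_hypersurface {m. M < mdeg m} B \<longleftrightarrow>
      x \<in> virial_hypersurface {m. 2 \<le> mdeg m} B" if "x \<in> phase_over W'" for x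
  proof -
    obtain \<mu> T n s P where x: "x = (\<mu>, T, n, s, P)" by (cases x)
    with that have "(T, n) \<in> W'" by (auto simp: phase_over_def)
    then show ?thesis
      using split[of T n] S_legendre[of "(T, n)"]
      by (auto simp: x f_def gauge_shift_def virial_hypersurface_def)
  qed
  have "f ` (phase_over W' \<inter> virial_hypersurface {m. 2 \<le> mdeg m} B) =
      phase_over W' \<inter> virial_hypersurface {m. M < mdeg m} B"
  proof -
    have "f ` {x \<in> phase_over W'. x \<in> virial_hypersurface {m. 2 \<le> mdeg m} B} =
        {y \<in> f ` phase_over W'. y \<in> virial_hypersurface {m. M < mdeg m} B}"
      using hypersurface by blast
    then show ?thesis
      unfolding bij_betw_imp_surj_on[OF bij] Int_def .
  qed
  moreover have "f 0 = 0"
  proof -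
    have "2 \<le> mdeg m" if "m \<in> F" for m
      using that by (simp add: F_def)
    then have "S (0, 0) = 0" "S\<^sub>T (0, 0) = 0" "S\<^sub>n (0, 0) = 0"
      unfolding S_def S\<^sub>T_def S\<^sub>n_def
      by (intro virial_sum_zero virial_gradient_zero; assumption)+
    then show ?thesis
      by (simp add: f_def gauge_shift_def zero_prod_def)
  qed
  moreover have "0 \<in> phase_over W'" "phase_over W' \<subseteq> phase_over W"
    using W' by (auto simp: phase_over_eq_vimage temperature_density_def zero_prod_def)
  ultimately show ?thesis
    using contact expansion by blast
qed

end
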